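(* Let $n\geq 1$ be an integer and let $\kappa\in(0,1)\cap\mathbb{Q}$ be such that $\Gamma(\kappa)$ is transcendental. For integers $M\geq 0$ define $$\widetilde{\beta}_{n}(M)=1-\frac{\min\{n,M+1\}}{M+1}.$$ Then for every integer $M\geq 0$: (i) $\delta_{n,\kappa}^{(+)}(M)\geq\widetilde{\beta}_{n}(M)$; and (ii) $\delta_{n,\kappa}^{(-)}(M)\geq\widetilde{\beta}_{n}(M)$; where, for fixed $n$, $$\widetilde{\beta}_{n}(M)\asymp 1-\frac{n}{M}\qquad\text{as } M\to\infty .$$
   Context: $\Gamma$ denotes the Euler Gamma function (meromorphically continued, with poles only at the non-positive integers) and $\Gamma^{(n)}$ its $n$-th derivative; "transcendental" means transcendental over $\mathbb{Q}$. For $M\in\mathbb{Z}_{\geq 0}$ put $\mathcal{L}_{\kappa}^{(+)}(M)=\{\kappa,1+\kappa,2+\kappa,\ldots,M+\kappa\}$ and $\mathcal{L}_{\kappa}^{(-)}(M)=\{\kappa,-1+\kappa,-2+\kappa,\ldots,-M+\kappa\}$. The densities of transcendental values are $$\delta_{n,\kappa}^{(\pm)}(M)=\frac{\#\left\{\widetilde{m}\in\mathcal{L}_{\kappa}^{(\pm)}(M) : \Gamma^{(n)}(\widetilde{m})\ \text{is transcendental}\right\}}{M+1}$$ (with the same sign chosen throughout). The notation $f(M)\asymp g(M)$ as $M\to\infty$ means asymptotic equivalence: $f(M)/g(M)\to 1$ as $M\to\infty$. *)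

theory Defs
  imports
    "HOL-Analysis.Analysis"
    "HOL-Computational_Algebra.Polynomial"
    "HOL-Library.Landau_Symbols"
begin

text \<open>
  The library's \<^const>\<open>algebraic\<close> uses integer coefficients; this is the same as being
  algebraic over the rationals (lemma \<open>algebraic_altdef\<close>).
\<close>

abbreviation transcendental :: "complex \<Rightarrow> bool" where
  "transcendental z \<equiv> \<not> algebraic z"

definition lattice_plus :: "real \<Rightarrow> nat \<Rightarrow> real set" where
  "lattice_plus \<kappa> M = {real m + \<kappa> | m. m \<le> M}"

definition lattice_minus :: "real \<Rightarrow> nat \<Rightarrow> real set" where
  "lattice_minus \<kappa> M = {- real m + \<kappa> | m. m \<le> M}"

text \<open>
  The derivatives are complex derivatives of the meromorphic Gamma function. For non-integer
  \<open>\<kappa>\<close> no point of the two sets is a pole, so the totalised values of \<^const>\<open>Gamma\<close> and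
  \<^const>\<open>deriv\<close> at poles play no role.
\<close>

definition density_plus :: "nat \<Rightarrow> real \<Rightarrow> nat \<Rightarrow> real" where
  "density_plus n \<kappa> M =
     real (card {x \<in> lattice_plus \<kappa> M. transcendental ((deriv ^^ n) Gamma (complex_of_real x))})
       / (real M + 1)"

definition density_minus :: "nat \<Rightarrow> real \<Rightarrow> nat \<Rightarrow> real" where
  "density_minus n \<kappa> M =
     real (card {x \<in> lattice_minus \<kappa> M. transcendental ((deriv ^^ n) Gamma (complex_of_real x))})
       / (real M + 1)"

definition beta_tilde :: "nat \<Rightarrow> nat \<Rightarrow> real" where
  "beta_tilde n M = 1 - real (min n (M + 1)) / (real M + 1)"

end

theory Submission
  imports Defs "HOL-Complex_Analysis.Cauchy_Integral_Formula" "HOL-Real_Asymp.Real_Asymp"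
begin

text \<open>
  Write \<open>\<kappa>\<close> for the rational base point. The claim amounts to this: along each of the two
  progressions \<open>\<kappa> + m\<close> and \<open>\<kappa> - m\<close>, at most \<open>n\<close> of the values \<open>\<Gamma>\<^sup>(\<^sup>n\<^sup>)\<close> are algebraic.

  Differentiating \<open>\<Gamma>(z + 1) = z \<Gamma>(z)\<close> repeatedly gives
  \<open>\<Gamma>\<^sup>(\<^sup>k\<^sup>)(z + 1) = z \<Gamma>\<^sup>(\<^sup>k\<^sup>)(z) + k \<Gamma>\<^sup>(\<^sup>k\<^sup>-\<^sup>1\<^sup>)(z)\<close>, a recurrence with rational
  coefficients at rational points. The algebraic numbers form a \<open>\<rat>\<close>-subspace of the complex
  numbers that misses \<open>\<Gamma>(\<kappa>)\<close>, so there is a \<open>\<rat>\<close>-linear functional \<open>\<phi>\<close> with rational values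
  that kills all algebraic numbers but not \<open>\<Gamma>(\<kappa>)\<close>
  (\<open>rat_functional_separating_algebraic\<close>). The rational numbers
  \<open>F k r = \<phi> (\<Gamma>\<^sup>(\<^sup>k\<^sup>)(r))\<close> satisfy the same recurrence, and \<open>F n\<close> vanishes wherever
  \<open>\<Gamma>\<^sup>(\<^sup>n\<^sup>)\<close> is algebraic. It remains to count zeros of a sequence in an ordered field.

  Dividing by the factors that \<open>\<Gamma>\<close> itself picks up along the progression turns the recurrence
  into \<open>\<Delta>v\<^sub>k\<^sub>+\<^sub>1 = w \<cdot> v\<^sub>k\<close> with positive weights \<open>w\<close> (with a shift of the index for \<open>\<kappa> - m\<close>),
  where \<open>v\<^sub>0\<close> is a nonzero constant. A discrete form of Rolle's theorem now shows that \<open>v\<^sub>n\<close>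
  behaves like a polynomial of degree \<open>n\<close>: it has at most \<open>n\<close> zeros (\<open>card_zeros_le\<close>).
\<close>

section \<open>Algebraic numbers as a rational vector space\<close>

interpretation ratvec: vector_space "\<lambda>(q::rat) (z::'a::field_char_0). of_rat q * z"
  by standard (auto simp: algebra_simps of_rat_add of_rat_mult)

lemma ratvec_mult_in_span:
  assumes "\<And>s. s \<in> S \<Longrightarrow> z * s \<in> ratvec.span T" and "x \<in> ratvec.span S"
  shows "z * x \<in> ratvec.span T"
  using assms(2)
proof (induction rule: ratvec.span_induct_alt)
  case base
  show ?case by (simp add: ratvec.span_zero)
next
  case (step c s y)
  have "of_rat c * (z * s) + z * y \<in> ratvec.span T"
    by (intro ratvec.span_add ratvec.span_scale assms(1) step)
  then show ?case by (simp add: algebra_simps)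
qed

lemma ratvec_mult_in_span_mult:
  assumes "x \<in> ratvec.span S" and "y \<in> ratvec.span T"
  shows "x * y \<in> ratvec.span ((\<lambda>(s, t). s * t) ` (S \<times> T))"
proof -
  have "s * y \<in> ratvec.span ((\<lambda>(s, t). s * t) ` (S \<times> T))" if "s \<in> S" for s
    using that by (intro ratvec_mult_in_span[OF _ assms(2)] ratvec.span_base) auto
  then have "y * x \<in> ratvec.span ((\<lambda>(s, t). s * t) ` (S \<times> T))"
    by (intro ratvec_mult_in_span[OF _ assms(1)]) (simp add: mult.commute)
  then show ?thesis by (simp add: mult.commute)
qed

lemma algebraic_if_rat_relation:
  fixes z :: "'a::field_char_0"
  assumes "(\<Sum>i\<le>N. of_rat (c i) * z ^ i) = 0" and "i \<le> N" and "c i \<noteq> 0"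
  shows "algebraic z"
proof (rule algebraicI')
  let ?p = "\<Sum>i\<le>N. monom (of_rat (c i) :: 'a) i"
  have coeff: "coeff ?p j = (if j \<le> N then of_rat (c j) else 0)" for j
    by (simp add: coeff_sum)
  show "coeff ?p j \<in> \<rat>" for j
    by (simp add: coeff)
  show "?p \<noteq> 0"
    using coeff[of i] assms(2,3) by auto
  show "poly ?p z = 0"
    using assms(1) by (simp add: poly_sum poly_monom)
qed

text \<open>
  Being algebraic is a finiteness condition: if multiplication by \<open>z\<close> preserves a
  finite-dimensional space containing \<open>1\<close>, that space contains all powers of \<open>z\<close>, and more powers
  than the dimension allows must be linearly dependent. In this form, unlike in terms of
  polynomials, closure under sums is easy to see.
\<close>

lemma algebraic_if_stable_span:
  fixes z :: "'a::field_char_0"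
  assumes fin: "finite S" and one: "1 \<in> ratvec.span S"
    and stable: "\<And>s. s \<in> S \<Longrightarrow> z * s \<in> ratvec.span S"
  shows "algebraic z"
proof -
  define N where "N = card S"
  have pow: "z ^ i \<in> ratvec.span S" for i
    by (induction i) (auto intro: one ratvec_mult_in_span[OF stable])
  show ?thesis
  proof (cases "inj_on (\<lambda>i. z ^ i) {..N}")
    case True
    \<comment> \<open>\<open>N + 1\<close> distinct vectors in the span of \<open>N\<close> vectors\<close>
    define P where "P = (\<lambda>i. z ^ i) ` {..N}"
    have "card P = Suc N"
      using True by (simp add: P_def card_image)
    then have "ratvec.dependent P"
      using ratvec.independent_span_bound[OF fin, of P] pow by (auto simp: P_def N_def)
    moreover have "finite P" by (simp add: P_def)
    ultimately obtain u v where u: "v \<in> P" "u v \<noteq> 0" "(\<Sum>v\<in>P. of_rat (u v) * v) = 0"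
      by (auto simp: ratvec.dependent_finite)
    from u(1) obtain i where i: "i \<le> N" "v = z ^ i" by (auto simp: P_def)
    have "(\<Sum>i\<le>N. of_rat (u (z ^ i)) * z ^ i) = 0"
      using u(3) True by (simp add: P_def sum.reindex)
    with i u(2) show ?thesis
      by (intro algebraic_if_rat_relation[where c = "\<lambda>i. u (z ^ i)" and i = i]) auto
  next
    case False
    then obtain i j where ij: "i \<noteq> j" "z ^ i = z ^ j"
      by (auto simp: inj_on_def)
    show ?thesis
    proof (rule algebraicI')
      show "coeff (monom 1 i - monom 1 j :: 'a poly) k \<in> \<rat>" for k
        by simp
      show "monom 1 i - monom 1 j \<noteq> (0 :: 'a poly)"
        using ij(1) by (auto simp: monom_eq_iff')
      show "poly (monom 1 i - monom 1 j) z = 0"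
        using ij(2) by (simp add: poly_monom)
    qed
  qed
qed

text \<open>
  The converse. The powers of \<open>z\<close> below the degree of an annihilating polynomial span a stable
  space, as the polynomial expresses the next power through them.
\<close>

lemma stable_span_if_algebraic:
  fixes z :: "'a::field_char_0"
  assumes "algebraic z"
  obtains S where "finite S" and "1 \<in> ratvec.span S"
    and "\<And>s. s \<in> S \<Longrightarrow> z * s \<in> ratvec.span S"
proof -
  obtain p where p: "\<forall>i. coeff p i \<in> \<rat>" "p \<noteq> 0" "poly p z = 0"
    using assms by (auto simp: algebraic_altdef)
  define d where "d = degree p"
  define S where "S = (\<lambda>i. z ^ i) ` {..<d}"
  have "d \<noteq> 0"
  proof
    assume "d = 0"
    then obtain c where "p = [:c:]" unfolding d_def by (rule degree_eq_zeroE)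
    with p(2,3) show False by simp
  qed
  have lc: "coeff p d \<noteq> 0"
    using p(2) by (simp add: d_def)
  have "(\<Sum>i<d. coeff p i * z ^ i) + coeff p d * z ^ d = 0"
    using p(3) by (simp add: poly_altdef d_def lessThan_Suc_atMost[symmetric])
  then have zd: "z ^ d = (\<Sum>i<d. - (coeff p i / coeff p d) * z ^ i)"
    using lc by (simp add: field_simps sum_negf sum_divide_distrib[symmetric] eq_neg_iff_add_eq_0)
  have "(- (coeff p i / coeff p d)) * z ^ i \<in> ratvec.span S" if "i < d" for i
  proof -
    have "- (coeff p i / coeff p d) \<in> \<rat>"
      using p(1) by (intro Rats_minus_iff[THEN iffD2] Rats_divide) auto
    then obtain q where "- (coeff p i / coeff p d) = of_rat q"
      by (elim Rats_cases)
    moreover have "z ^ i \<in> S" using that by (simp add: S_def)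
    ultimately show ?thesis
      by (simp only: ratvec.span_scale ratvec.span_base)
  qed
  then have zd': "z ^ d \<in> ratvec.span S"
    unfolding zd by (intro ratvec.span_sum) auto
  show ?thesis
  proof
    show "finite S" by (simp add: S_def)
    have "z ^ 0 \<in> S" using \<open>d \<noteq> 0\<close> unfolding S_def by blast
    then show "1 \<in> ratvec.span S" by (auto intro: ratvec.span_base)
  next
    fix s assume "s \<in> S"
    then obtain i where i: "i < d" "s = z ^ i" by (auto simp: S_def)
    show "z * s \<in> ratvec.span S"
    proof (cases "Suc i < d")
      case True
      then have "z ^ Suc i \<in> S" unfolding S_def by blast
      then show ?thesis by (auto simp: i intro: ratvec.span_base)
    next
      case False
      with i have "z * s = z ^ d"
        by (metis Suc_lessI power_Suc)
      with zd' show ?thesis by simp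
    qed
  qed
qed

text \<open>
  The products of two stable generating sets, one for each summand, generate a space that is stable
  under both summands, hence under their sum.
\<close>

lemma algebraic_add:
  fixes x y :: "'a::field_char_0"
  assumes "algebraic x" and "algebraic y"
  shows "algebraic (x + y)"
proof -
  obtain S where S: "finite S" "1 \<in> ratvec.span S" "\<And>s. s \<in> S \<Longrightarrow> x * s \<in> ratvec.span S"
    using stable_span_if_algebraic[OF assms(1)] by blast
  obtain T where T: "finite T" "1 \<in> ratvec.span T" "\<And>t. t \<in> T \<Longrightarrow> y * t \<in> ratvec.span T"
    using stable_span_if_algebraic[OF assms(2)] by blast
  show ?thesis
  proof (rule algebraic_if_stable_span)
    show "finite ((\<lambda>(s, t). s * t) ` (S \<times> T))"
      using S(1) T(1) by simp
    show "1 \<in> ratvec.span ((\<lambda>(s, t). s * t) ` (S \<times> T))"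
      using ratvec_mult_in_span_mult[OF S(2) T(2)] by simp
    fix u assume "u \<in> (\<lambda>(s, t). s * t) ` (S \<times> T)"
    then obtain s t where st: "s \<in> S" "t \<in> T" "u = s * t" by auto
    have "(x * s) * t + s * (y * t) \<in> ratvec.span ((\<lambda>(s, t). s * t) ` (S \<times> T))"
      by (intro ratvec.span_add ratvec_mult_in_span_mult S(3) T(3) ratvec.span_base st)
    then show "(x + y) * u \<in> ratvec.span ((\<lambda>(s, t). s * t) ` (S \<times> T))"
      by (simp add: st algebra_simps)
  qed
qed

lemma algebraic_of_rat_mult:
  fixes x :: "'a::field_char_0"
  assumes "algebraic x"
  shows "algebraic (of_rat q * x)"
proof -
  obtain S where S: "finite S" "1 \<in> ratvec.span S" "\<And>s. s \<in> S \<Longrightarrow> x * s \<in> ratvec.span S"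
    using stable_span_if_algebraic[OF assms(1)] by blast
  show ?thesis
    by (rule algebraic_if_stable_span[OF S(1,2)])
       (use ratvec.span_scale[OF S(3)] in \<open>simp add: mult.assoc\<close>)
qed

text \<open>
  Since \<open>g\<close> lies outside the subspace of algebraic numbers, adjoining it to a basis of that
  subspace keeps linear independence, and a linear functional may take any prescribed values on an
  independent set. Applying such a functional replaces a question about transcendence by one about
  signs of rational numbers.
\<close>

lemma rat_functional_separating_algebraic:
  fixes g :: "'a::field_char_0"
  assumes "\<not> algebraic g"
  obtains \<phi> :: "'a \<Rightarrow> rat"
    where "\<And>x y. \<phi> (x + y) = \<phi> x + \<phi> y" and "\<And>q x. \<phi> (of_rat q * x) = q * \<phi> x"
      and "\<And>x. algebraic x \<Longrightarrow> \<phi> x = 0" and "\<phi> g \<noteq> 0"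
proof -
  interpret pair: vector_space_pair "\<lambda>q (z::'a). of_rat q * z" "\<lambda>q (r::rat). q * r"
    by unfold_locales (auto simp: algebra_simps)
  define A where "A = {x::'a. algebraic x}"
  have sub: "ratvec.subspace A"
    unfolding ratvec.subspace_def A_def by (auto intro: algebraic_add algebraic_of_rat_mult)
  obtain B where B: "B \<subseteq> A" "ratvec.independent B" "A \<subseteq> ratvec.span B"
    using ratvec.maximal_independent_subset .
  have "ratvec.span B \<subseteq> A"
    using B(1) sub by (rule ratvec.span_minimal)
  then have g: "g \<notin> ratvec.span B"
    using assms by (auto simp: A_def)
  obtain \<phi> where lin: "Vector_Spaces.linear (\<lambda>q z. of_rat q * z) (*) \<phi>"
    and \<phi>: "\<forall>x\<in>insert g B. \<phi> x = (if x = g then 1 else 0)"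
    using pair.linear_independent_extend[OF ratvec.independent_insertI[OF g B(2)],
      of "\<lambda>x. if x = g then 1 else 0"] by blast
  interpret lin: Vector_Spaces.linear "\<lambda>q z. of_rat q * z" "(*)" \<phi>
    by (fact lin)
  have B0: "\<phi> b = 0" if "b \<in> B" for b
    using \<phi> g that by (auto dest: ratvec.span_base)
  show ?thesis
  proof
    show "\<phi> (x + y) = \<phi> x + \<phi> y" for x y by (rule lin.add)
    show "\<phi> (of_rat q * x) = q * \<phi> x" for q x by (rule lin.scale)
    show "\<phi> g \<noteq> 0" using \<phi> by simp
    show "\<phi> x = 0" if "algebraic x" for x
      using that B(3) by (intro lin.eq_0_on_span[OF B0]) (auto simp: A_def)
  qed
qed

section \<open>Counting zeros by a discrete Rolle argument\<close>

text \<open>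
  If \<open>v (Suc k)\<close> alternates weakly in sign along \<open>p\<close>, then between \<open>p i\<close> and \<open>p (Suc i)\<close> it
  moves weakly in a known direction, so some increment there, and with it the value of \<open>v k\<close>
  belonging to that increment, has a known weak sign. Thus \<open>v k\<close> alternates weakly along a chain
  that is shorter by one point. At level \<open>0\<close> a nonzero constant would alternate along two points.
  Weak signs, with zeros counting as either sign, make this step free of case distinctions.
  The map \<open>\<sigma>\<close> allows the increment at \<open>m\<close> to be governed by the value of \<open>v k\<close> at either end
  of the step.
\<close>

lemma no_alternating_chain:
  fixes v :: "nat \<Rightarrow> nat \<Rightarrow> 'a::linordered_field"
  assumes \<sigma>: "strict_mono \<sigma>"
    and pos: "\<And>k m. w k m > 0"
    and step: "\<And>k m. v (Suc k) (Suc m) - v (Suc k) m = w k m * v k (\<sigma> m)"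
    and const: "\<And>m. v 0 (Suc m) = v 0 m" and nz: "v 0 0 \<noteq> 0"
  assumes "s \<noteq> 0" and "strict_mono_on {..Suc k} p"
    and "\<And>i. i \<le> Suc k \<Longrightarrow> s * (-1) ^ i * v k (p i) \<ge> 0"
  shows False
  using assms(6-)
proof (induction k arbitrary: s p)
  case 0
  have c: "v 0 m = v 0 0" for m
    by (induction m) (simp_all add: const)
  from "0.prems"(3)[of 0] "0.prems"(3)[of 1] have "s * v 0 0 = 0"
    by (simp add: c[of "p _"])
  with "0.prems"(1) nz show False by simp
next
  case (Suc k)
  have "\<exists>r. p i \<le> r \<and> r < p (Suc i) \<and> (- s) * (-1) ^ i * v k (\<sigma> r) \<ge> 0" if i: "i \<le> Suc k" for i
  proof (rule ccontr)
    assume "\<not> ?thesis"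
    then have neg: "(- s) * (-1) ^ i * v k (\<sigma> r) < 0" if "r \<in> {p i..<p (Suc i)}" for r
      using that by force
    have less: "p i < p (Suc i)"
      using Suc.prems(2) i by (auto simp: strict_mono_on_def)
    have "(- s) * (-1) ^ i * (v (Suc k) (p (Suc i)) - v (Suc k) (p i))
        = (\<Sum>r=p i..<p (Suc i). (- s) * (-1) ^ i * (v (Suc k) (Suc r) - v (Suc k) r))"
      using less by (simp only: sum_distrib_left[symmetric] sum_Suc_diff')
    also have "\<dots> = (\<Sum>r=p i..<p (Suc i). w k r * ((- s) * (-1) ^ i * v k (\<sigma> r)))"
      by (simp only: step mult_ac)
    also have "\<dots> < (\<Sum>r=p i..<p (Suc i). 0)"
      by (rule sum_strict_mono[OF _ _ mult_pos_neg[OF pos neg]]) (use less in simp_all)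
    finally show False
      using Suc.prems(3)[of i] Suc.prems(3)[of "Suc i"] i by (simp add: algebra_simps)
  qed
  then obtain r where r: "p i \<le> r i" "r i < p (Suc i)" "(- s) * (-1) ^ i * v k (\<sigma> (r i)) \<ge> 0"
    if "i \<le> Suc k" for i
    by metis
  have "r i < r j" if "i < j" "j \<le> Suc k" for i j
  proof -
    have "r i < p (Suc i)" using that r by simp
    also have "p (Suc i) \<le> p j"
      using strict_mono_onD[OF Suc.prems(2), of "Suc i" j] that by (cases "Suc i = j") auto
    also have "p j \<le> r j" using that r by simp
    finally show ?thesis .
  qed
  then have "strict_mono_on {..Suc k} (\<lambda>i. \<sigma> (r i))"
    using \<sigma> by (auto simp: strict_mono_on_def strict_mono_def)
  with Suc.IH[of "- s" "\<lambda>i. \<sigma> (r i)"] Suc.prems(1) r(3) show False by simp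
qed

text \<open>
  Zeros may be given any sign in a weakly alternating chain, so a chain of \<open>n + 1\<close> zeros
  alternates for both choices of the global sign \<open>s\<close>. That freedom accommodates one further point
  \<open>x\<close>, of whatever sign, and yields the \<open>n + 2\<close> points that \<open>no_alternating_chain\<close> excludes.
\<close>

lemma card_zeros_le:
  fixes v :: "nat \<Rightarrow> nat \<Rightarrow> 'a::linordered_field"
  assumes "strict_mono \<sigma>"
    and "\<And>k m. w k m > 0"
    and "\<And>k m. v (Suc k) (Suc m) - v (Suc k) m = w k m * v k (\<sigma> m)"
    and "\<And>m. v 0 (Suc m) = v 0 m" and "v 0 0 \<noteq> 0"
  assumes fin: "finite A" and zero: "\<And>m. m \<in> A \<Longrightarrow> v n m = 0"
  shows "card A \<le> n"
proof (rule ccontr)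
  assume "\<not> card A \<le> n"
  then obtain A' where A': "A' \<subseteq> A" "card A' = Suc n"
    using obtain_subset_with_card_n[of "Suc n" A] by auto
  then have "finite A'" using fin finite_subset by blast
  obtain x where x: "x \<notin> A'"
    using \<open>finite A'\<close> ex_new_if_finite infinite_UNIV_nat by blast
  have card: "card (insert x A') = Suc (Suc n)"
    using x A' \<open>finite A'\<close> by simp
  obtain h where h: "bij_betw h {..<Suc (Suc n)} (insert x A')" "strict_mono_on {..<Suc (Suc n)} h"
    using ex_bij_betw_strict_mono_card[of "insert x A'"] \<open>finite A'\<close> card by auto
  obtain j where j: "j < Suc (Suc n)" "h j = x"
    using h(1) by (metis bij_betw_iff_bijections insertI1 lessThan_iff)
  define s where "s = (-1) ^ j * (if v n x \<ge> 0 then 1 else - 1 :: 'a)"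
  have "s \<noteq> 0" by (simp add: s_def)
  moreover have "strict_mono_on {..Suc n} h"
    using h(2) by (simp add: lessThan_Suc_atMost)
  moreover have "s * (-1) ^ i * v n (h i) \<ge> 0" if "i \<le> Suc n" for i
  proof (cases "i = j")
    case True
    then show ?thesis by (simp add: s_def j flip: power_add mult_2)
  next
    case False
    then have "h i \<noteq> x"
      using h(1) j that by (auto simp: bij_betw_def inj_on_def)
    moreover have "h i \<in> insert x A'"
      using h(1) that by (auto simp: bij_betw_def)
    ultimately have "v n (h i) = 0" using zero A'(1) by auto
    then show ?thesis by simp
  qed
  ultimately show False
    using no_alternating_chain[OF assms(1-5)] by blast
qed

section \<open>Algebraic values of the derivatives of Gamma\<close>

text \<open>At \<open>k = 0\<close> the truncated index \<open>k - 1\<close> is harmless because of the factor \<open>of_nat k\<close>.\<close>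

lemma higher_deriv_Gamma_plus1:
  fixes z :: complex
  assumes "z \<notin> \<int>\<^sub>\<le>\<^sub>0"
  shows "(deriv ^^ k) Gamma (z + 1) = z * (deriv ^^ k) Gamma z + of_nat k * (deriv ^^ (k - 1)) Gamma z"
  using assms
proof (induction k arbitrary: z)
  case 0
  then show ?case by (simp add: Gamma_plus1)
next
  case (Suc k)
  define U where "U = - (\<int>\<^sub>\<le>\<^sub>0 :: complex set)"
  have U: "open U" "z \<in> U" using Suc.prems by (auto simp: U_def)
  have z1: "z + 1 \<in> U" using Suc.prems by (auto simp: U_def dest: plus_one_in_nonpos_Ints_imp)
  have hol: "(deriv ^^ j) Gamma holomorphic_on U" for j
    by (intro holomorphic_higher_deriv holomorphic_Gamma U) (auto simp: U_def)
  have D: "((deriv ^^ j) Gamma has_field_derivative (deriv ^^ Suc j) Gamma x) (at x)" if "x \<in> U" for j x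
    using holomorphic_derivI[OF hol U(1) that] by simp
  have "((\<lambda>z. (deriv ^^ k) Gamma (z + 1)) has_field_derivative (deriv ^^ Suc k) Gamma (z + 1)) (at z)"
    using D[OF z1] by (rule DERIV_shift[THEN iffD1])
  moreover have "((\<lambda>z. (deriv ^^ k) Gamma (z + 1)) has_field_derivative
      z * (deriv ^^ Suc k) Gamma z + of_nat (Suc k) * (deriv ^^ k) Gamma z) (at z)"
  proof (rule DERIV_cong_ev[THEN iffD1, OF refl _ refl])
    show "\<forall>\<^sub>F x in nhds z. x * (deriv ^^ k) Gamma x + of_nat k * (deriv ^^ (k - 1)) Gamma x
        = (deriv ^^ k) Gamma (x + 1)"
      using eventually_nhds_in_open[OF U] by eventually_elim (auto simp: Suc.IH U_def)
    have "of_nat k * (deriv ^^ Suc (k - 1)) Gamma z = of_nat k * (deriv ^^ k) Gamma z"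
      by (cases k) auto
    then show "((\<lambda>x. x * (deriv ^^ k) Gamma x + of_nat k * (deriv ^^ (k - 1)) Gamma x)
        has_field_derivative
          z * (deriv ^^ Suc k) Gamma z + of_nat (Suc k) * (deriv ^^ k) Gamma z) (at z)"
      using U(2) by (auto intro!: derivative_eq_intros D simp: algebra_simps simp del: funpow.simps)
  qed
  ultimately show ?case
    by (simp add: DERIV_unique del: funpow.simps)
qed

text \<open>
  The recurrence for \<open>F\<close> is normalised so that \<open>v 0\<close> becomes constant. Going up, \<open>\<Gamma>\<close> picks up
  the factors \<open>q + m\<close>, which form a Pochhammer symbol; going down, it loses the factors
  \<open>q - (m + 1)\<close>, which are collected in \<open>d\<close>. The bounds on \<open>q\<close> give all factors in one direction
  the same sign, and that makes the weights positive.
\<close>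

lemma card_algebraic_higher_deriv_Gamma_le:
  fixes q :: rat
  assumes q: "0 < q" "q < 1" and trans: "transcendental (Gamma (of_rat q))"
  shows "card {m. m \<le> M \<and> algebraic ((deriv ^^ n) Gamma (of_rat (q + of_nat m) :: complex))} \<le> n"
    and "card {m. m \<le> M \<and> algebraic ((deriv ^^ n) Gamma (of_rat (q - of_nat m) :: complex))} \<le> n"
proof -
  obtain \<phi> :: "complex \<Rightarrow> rat"
    where add: "\<And>x y. \<phi> (x + y) = \<phi> x + \<phi> y" and scale: "\<And>q x. \<phi> (of_rat q * x) = q * \<phi> x"
      and alg: "\<And>x. algebraic x \<Longrightarrow> \<phi> x = 0" and nz: "\<phi> (Gamma (of_rat q)) \<noteq> 0"
    using rat_functional_separating_algebraic[OF trans] by blast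
  define F where "F k r = \<phi> ((deriv ^^ k) Gamma (of_rat r))" for k r
  have F: "F k (r + 1) = r * F k r + of_nat k * F (k - 1) r" if "r \<notin> \<int>" for k r
  proof -
    have "(of_rat r :: complex) \<notin> \<int>\<^sub>\<le>\<^sub>0"
    proof
      assume "(of_rat r :: complex) \<in> \<int>\<^sub>\<le>\<^sub>0"
      then obtain i where "(of_rat r :: complex) = of_rat (of_int i)"
        by (auto elim: nonpos_Ints_cases)
      then have "r = of_int i" by (simp only: of_rat_eq_iff)
      with that show False by simp
    qed
    from higher_deriv_Gamma_plus1[OF this, of k]
    have "(deriv ^^ k) Gamma (of_rat (r + 1)) = of_rat r * (deriv ^^ k) Gamma (of_rat r :: complex)
        + of_rat (of_nat k) * (deriv ^^ (k - 1)) Gamma (of_rat r)"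
      by (simp add: of_rat_add)
    then show ?thesis by (simp only: F_def add scale)
  qed
  have q_nint: "q \<notin> \<int>"
    using q by (auto elim!: Ints_cases)
  have nint: "q + of_int i \<notin> \<int>" for i
    using q_nint Ints_diff[of "q + of_int i" "of_int i"] by auto
  show "card {m. m \<le> M \<and> algebraic ((deriv ^^ n) Gamma (of_rat (q + of_nat m) :: complex))} \<le> n"
    (is "card ?A \<le> n")
  proof -
    define v where "v k m = F k (q + of_nat m) / pochhammer q m" for k m
    define w where "w k m = of_nat (Suc k) / (q + of_nat m)" for k m
    have poch: "pochhammer q m \<noteq> 0" for m
      using q pochhammer_pos[of q m] by simp
    have qm: "q + of_nat m > 0" for m
      using q by (simp add: add_pos_nonneg)
    have F': "F k (q + of_nat (Suc m)) = (q + of_nat m) * F k (q + of_nat m) + of_nat k * F (k - 1) (q + of_nat m)" for k m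
      using F[of "q + of_nat m" k] nint[of "int m"] by (simp add: add_ac)
    show ?thesis
    proof (rule card_zeros_le[where v = v and w = w and \<sigma> = id])
      show "strict_mono (id :: nat \<Rightarrow> nat)" by (simp add: strict_mono_def)
      show "w k m > 0" for k m
        using qm[of m] by (simp add: w_def)
      show "v (Suc k) (Suc m) - v (Suc k) m = w k m * v k (id m)" for k m
        using qm[of m] poch[of m] unfolding v_def w_def F' pochhammer_Suc
        by (simp add: divide_simps)
      show "v 0 (Suc m) = v 0 m" for m
        using qm[of m] poch[of m] unfolding v_def F' pochhammer_Suc by simp
      show "v 0 0 \<noteq> 0" using nz by (simp add: v_def F_def)
      show "v n m = 0" if "m \<in> ?A" for m
        using that by (simp add: v_def F_def alg)
      show "finite ?A"
        by (rule finite_subset[of _ "{..M}"]) auto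
    qed
  qed
  show "card {m. m \<le> M \<and> algebraic ((deriv ^^ n) Gamma (of_rat (q - of_nat m) :: complex))} \<le> n"
    (is "card ?A \<le> n")
  proof -
    define d where "d m = (\<Prod>i<m. q - of_nat (Suc i))" for m
    define v where "v k m = d m * F k (q - of_nat m)" for k m
    define w where "w k m = of_nat (Suc k) / (of_nat (Suc m) - q)" for k m
    have qm: "of_nat (Suc m) - q > 0" for m
      using q by (simp add: add_strict_increasing)
    have d: "d (Suc m) = d m * (q - of_nat (Suc m))" for m
      by (simp add: d_def)
    have F': "F k (q - of_nat m) = (q - of_nat (Suc m)) * F k (q - of_nat (Suc m))
        + of_nat k * F (k - 1) (q - of_nat (Suc m))" for k m
      using F[of "q - of_nat (Suc m)" k] nint[of "- int (Suc m)"] by (simp add: algebra_simps)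
    show ?thesis
    proof (rule card_zeros_le[where v = v and w = w and \<sigma> = Suc])
      show "strict_mono Suc" by (simp add: strict_mono_def)
      show "w k m > 0" for k m
        using qm[of m] by (simp add: w_def)
      show "v (Suc k) (Suc m) - v (Suc k) m = w k m * v k (Suc m)" for k m
      proof -
        have "v (Suc k) (Suc m) - v (Suc k) m = - (d m * (of_nat (Suc k) * F k (q - of_nat (Suc m))))"
          unfolding v_def F'[of "Suc k" m] d by (simp add: algebra_simps)
        also have "\<dots> = w k m * v k (Suc m)"
          using qm[of m] unfolding v_def w_def d by (simp add: divide_simps) (simp add: algebra_simps)
        finally show ?thesis .
      qed
      show "v 0 (Suc m) = v 0 m" for m
        unfolding v_def F'[of 0 m] d by simp
      show "v 0 0 \<noteq> 0" using nz by (simp add: v_def F_def d_def)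
      show "v n m = 0" if "m \<in> ?A" for m
        using that by (simp add: v_def F_def alg)
      show "finite ?A"
        by (rule finite_subset[of _ "{..M}"]) auto
    qed
  qed
qed

section \<open>Densities\<close>

lemma beta_tilde_le_density:
  fixes f :: "nat \<Rightarrow> real"
  assumes "inj f" and "card {m. m \<le> M \<and> \<not> P (f m)} \<le> n"
  shows "beta_tilde n M \<le> real (card {x \<in> {f m | m. m \<le> M}. P x}) / (real M + 1)"
proof -
  define good bad where "good = {m. m \<le> M \<and> P (f m)}" and "bad = {m. m \<le> M \<and> \<not> P (f m)}"
  have "{x \<in> {f m | m. m \<le> M}. P x} = f ` good"
    by (auto simp: good_def)
  then have card: "card {x \<in> {f m | m. m \<le> M}. P x} = card good"
    using assms(1) by (simp add: card_image inj_on_def inj_def)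
  have "good \<union> bad = {..M}" "good \<inter> bad = {}" "finite good" "finite bad"
    by (auto simp: good_def bad_def)
  then have "card good + card bad = M + 1"
    using card_Un_disjoint[of good bad] by simp
  moreover have "card bad \<le> n" using assms(2) by (simp add: bad_def)
  ultimately have "real M + 1 - real (min n (M + 1)) \<le> real (card good)"
    by linarith
  then have "(real M + 1 - real (min n (M + 1))) / (real M + 1) \<le> real (card good) / (real M + 1)"
    by (rule divide_right_mono) simp
  then show ?thesis
    unfolding card beta_tilde_def by (simp add: diff_divide_distrib)
qed

lemma beta_tilde_asymp_equiv: "beta_tilde n \<sim>[at_top] (\<lambda>M. 1 - real n / real M)"
proof -
  have "(\<lambda>M. 1 - real n / (real M + 1)) \<longlonglongrightarrow> 1" "(\<lambda>M. 1 - real n / real M) \<longlonglongrightarrow> 1"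
    by real_asymp+
  moreover have "\<forall>\<^sub>F M in at_top. 1 - real n / (real M + 1) = beta_tilde n M"
    using eventually_ge_at_top[of n] by eventually_elim (simp add: beta_tilde_def)
  ultimately have "beta_tilde n \<longlonglongrightarrow> 1"
    using tendsto_cong by fast
  then have "(\<lambda>M. beta_tilde n M / (1 - real n / real M)) \<longlonglongrightarrow> 1 / 1"
    using \<open>(\<lambda>M. 1 - real n / real M) \<longlonglongrightarrow> 1\<close> by (rule tendsto_divide) simp
  then show ?thesis
    by (intro asymp_equivI') simp
qed

theorem corollary2:
  fixes n :: nat and \<kappa> :: real
  assumes "n \<ge> 1"
    and "0 < \<kappa>" and "\<kappa> < 1" and "\<kappa> \<in> \<rat>"
    and "transcendental (Gamma (complex_of_real \<kappa>))"
  shows "(\<forall>M. density_plus n \<kappa> M \<ge> beta_tilde n M) \<and>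
         (\<forall>M. density_minus n \<kappa> M \<ge> beta_tilde n M) \<and>
         beta_tilde n \<sim>[at_top] (\<lambda>M. 1 - real n / real M)"
proof (intro conjI allI beta_tilde_asymp_equiv)
  obtain q where \<kappa>: "\<kappa> = of_rat q"
    using assms(4) by (elim Rats_cases)
  have q: "0 < q" "q < 1" using assms(2,3) by (simp_all add: \<kappa>)
  have of_real: "complex_of_real (of_rat r) = of_rat r" for r
    by (cases r) (simp add: of_rat_rat)
  have trans: "transcendental (Gamma (of_rat q))"
    using assms(5) by (simp add: \<kappa> of_real)
  note card_le = card_algebraic_higher_deriv_Gamma_le[OF q trans]
  fix M
  have plus: "complex_of_real (real m + \<kappa>) = of_rat (q + of_nat m)" for m
    by (simp add: \<kappa> of_real of_rat_add)
  have "card {m. m \<le> M \<and> \<not> transcendental ((deriv ^^ n) Gamma (complex_of_real (real m + \<kappa>)))} \<le> n"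
    unfolding plus not_not by (rule card_le(1))
  then show "density_plus n \<kappa> M \<ge> beta_tilde n M"
    unfolding density_plus_def lattice_plus_def
    by (intro beta_tilde_le_density[where f = "\<lambda>m. real m + \<kappa>"
          and P = "\<lambda>x. transcendental ((deriv ^^ n) Gamma (complex_of_real x))"])
       (simp_all add: inj_def)
  have minus: "complex_of_real (- real m + \<kappa>) = of_rat (q - of_nat m)" for m
    by (simp add: \<kappa> of_real of_rat_diff)
  have "card {m. m \<le> M \<and> \<not> transcendental ((deriv ^^ n) Gamma (complex_of_real (- real m + \<kappa>)))} \<le> n"
    unfolding minus not_not by (rule card_le(2))
  then show "density_minus n \<kappa> M \<ge> beta_tilde n M"
    unfolding density_minus_def lattice_minus_def
    by (intro beta_tilde_le_density[where f = "\<lambda>m. - real m + \<kappa>"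
          and P = "\<lambda>x. transcendental ((deriv ^^ n) Gamma (complex_of_real x))"])
       (simp_all add: inj_def)
qed

end
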